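(* $$\lim_{n \to \infty} \frac{\lambda(n,n)}{n^3} = \frac{1}{2},$$ where $n$ ranges over the positive integers.
   Context: A Davenport--Schinzel sequence of order $s$ over an $m$-letter alphabet is a finite sequence of letters from an alphabet of size $m$ (not every letter has to occur) with no immediate repetitions (no two adjacent terms are equal) and with no alternating subsequence of length $s+2$, i.e. no (not necessarily contiguous) subsequence of the form $a, b, a, b, \ldots$ of length $s+2$ with $a \neq b$. For positive integers $s, m$, $\lambda(s,m)$ denotes the maximum length of a Davenport--Schinzel sequence of order $s$ over an $m$-letter alphabet. *)

theory Defs
  imports Complex_Main "HOL-Library.Sublist"
begin

definition alternation :: "nat \<Rightarrow> 'a \<Rightarrow> 'a \<Rightarrow> 'a list" where
  "alternation k a b = map (\<lambda>i. if even i then a else b) [0..<k]"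

definition davenport_schinzel :: "nat \<Rightarrow> 'a set \<Rightarrow> 'a list \<Rightarrow> bool" where
  "davenport_schinzel s A xs \<longleftrightarrow>
     set xs \<subseteq> A \<and> distinct_adj xs \<and>
     (\<forall>a b. a \<noteq> b \<longrightarrow> \<not> subseq (alternation (s + 2) a b) xs)"

text \<open>
  The choice of the alphabet is immaterial up to renaming of the letters, so the first
  \<open>m\<close> natural numbers serve as the alphabet of size \<open>m\<close>.
\<close>

definition ds_max_length :: "nat \<Rightarrow> nat \<Rightarrow> nat" where
  "ds_max_length s m = Max {length xs | xs :: nat list. davenport_schinzel s {..<m} xs}"

end

theory Submission
  imports Defs "HOL-Number_Theory.Cong" "HOL-Real_Asymp.Real_Asymp"
begin

text \<open>
  The constant \<open>1/2\<close> comes from \<open>n choose 2\<close> pairs of letters times \<open>n\<close> adjacencies per pair.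
  In a Davenport--Schinzel sequence of order \<open>s\<close>, two letters can be neighbours at most \<open>s\<close>
  times, since \<open>t\<close> adjacencies of \<open>a\<close> and \<open>b\<close> force an alternation of length \<open>t + 1\<close>.
  Summing over the pairs gives \<open>\<lambda>(s, m) \<le> (m choose 2) s + 1\<close>
  (\<open>ds_max_length_le\<close>), hence the upper bound.

  For the lower bound, almost every change between \<open>a\<close> and \<open>b\<close> must be an actual adjacency.
  Concatenate, over all pairs, blocks \<open>abab\<dots>ab\<close> of length close to \<open>n\<close>; the only question is in
  which order. Blocks \<open>ac\<close> and \<open>bc\<close> with other partners also make \<open>a\<close> and \<open>b\<close> alternate, and in
  a careless order this costs up to \<open>2 n\<close> further alternations. The remedy is to
  regard the letters as the points of a linear space (each two points lie on exactly one line) and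
  to group the pairs by the line that joins them. A line other than \<open>ab\<close> contains at most one of
  \<open>a\<close>, \<open>b\<close>, so all its blocks together add at most one run. The waste is thus of the order of the
  number of lines through a point plus the size of a line
  (\<open>ds_max_length_ge_linear_space\<close>), and both have to be small compared with \<open>n\<close>.

  An affine plane over a prime field of suitable size would do, but a cheaper space suffices,
  without any information on the distribution of primes. Fix a width \<open>r\<close> and place the \<open>n\<close>
  letters in a strip of \<open>r\<close> columns of height \<open>q\<close>, with \<open>q\<close> about \<open>n / r\<close> and \<open>q \<equiv> 1\<close> modulo \<open>r!\<close>. Differences of distinct
  column numbers are then invertible modulo \<open>q\<close>, so the columns and the lines
  \<open>y = k x + c\<close> modulo \<open>q\<close> form a linear space (\<open>strip_linear_space\<close>) with at most \<open>q + 1\<close> lines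
  through each point and at most \<open>q\<close> points on each line. This yields
  \<open>\<lambda>(n, n) \<ge> (n choose 2) (n - 4 n / r - O(1))\<close> for every fixed \<open>r\<close>
  (\<open>ds_max_length_diagonal_ge\<close>); let first \<open>n\<close> and then \<open>r\<close> tend to infinity.
\<close>

section \<open>Runs and alternating subsequences\<close>

abbreviation runs :: "'a list \<Rightarrow> nat" where
  "runs xs \<equiv> length (remdups_adj xs)"

text \<open>
  For \<open>a \<noteq> b\<close> this is the length of a longest alternation of \<open>a\<close> and \<open>b\<close> in \<open>xs\<close>. Counting runs instead of
  searching for subsequences makes the quantity subadditive under concatenation, and this is what
  the lower bound needs.
\<close>

definition pair_runs :: "'a \<Rightarrow> 'a \<Rightarrow> 'a list \<Rightarrow> nat" where
  "pair_runs a b xs = runs (filter (\<lambda>x. x \<in> {a, b}) xs)"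

lemma runs_Cons_ge: "runs xs \<le> runs (x # xs)"
  by (cases xs) (auto simp: remdups_adj_Cons')

lemma runs_Cons_le: "runs (x # xs) \<le> Suc (runs xs)"
  by (cases xs) auto

lemma runs_Cons_Cons: "runs (x # y # xs) = (if x = y then 0 else 1) + runs (y # xs)"
  by simp

text \<open>
  Without the common first letter \<open>z\<close> the induction fails: when both lists are extended by the same
  letter, that letter may merge with the first run of the longer list only.
\<close>

lemma runs_mono_Cons:
  assumes "subseq xs ys"
  shows "runs (z # xs) \<le> runs (z # ys)"
  using assms
proof (induction arbitrary: z rule: list_emb.induct)
  case (list_emb_Nil ys)
  then show ?case by (simp add: Suc_le_eq)
next
  case (list_emb_Cons xs ys y)
  have "runs (z # ys) \<le> runs (z # y # ys)"
    using runs_Cons_le[of z ys] runs_Cons_ge[of ys y] by (simp only: runs_Cons_Cons) auto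
  then show ?case using list_emb_Cons.IH[of z] by linarith
next
  case (list_emb_Cons2 x y xs ys)
  then show ?case by (simp only: runs_Cons_Cons) auto
qed

lemma runs_mono:
  assumes "subseq xs ys"
  shows "runs xs \<le> runs ys"
proof (cases xs)
  case (Cons x xs')
  obtain us vs where "ys = us @ x # vs" "subseq xs' vs"
    using list_emb_ConsD[OF assms[unfolded Cons]] by blast
  have "runs (x # vs) \<le> runs (us @ x # vs)"
  proof (induction us)
    case (Cons u us)
    then show ?case using runs_Cons_ge[of "us @ x # vs" u] by simp
  qed simp
  then show ?thesis
    using runs_mono_Cons[OF \<open>subseq xs' vs\<close>, of x] Cons \<open>ys = us @ x # vs\<close> by simp
qed simp

lemma runs_append_le: "runs (xs @ ys) \<le> runs xs + runs ys"
proof (induction xs rule: remdups_adj.induct)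
  case (2 x)
  then show ?case using runs_Cons_le[of x ys] by simp
qed auto

text \<open>Only the runs on either side of the junction can merge, so at most one run is lost.\<close>

lemma runs_append_ge: "runs xs + runs ys \<le> Suc (runs (xs @ ys))"
proof (cases ys)
  case (Cons y zs)
  have "runs xs \<le> runs (xs @ [y])" by (intro runs_mono subseq_rev_drop_many) simp
  moreover have "runs (xs @ ys) = runs (xs @ [y]) + (runs ys - 1)"
    unfolding Cons by (subst remdups_adj_append) simp
  moreover have "1 \<le> runs ys" unfolding Cons by (simp add: Suc_le_eq)
  ultimately show ?thesis by linarith
qed simp

lemma runs_constant: "set xs \<subseteq> {a} \<Longrightarrow> runs xs \<le> 1"
  by (induction xs rule: remdups_adj.induct) auto

lemma pair_runs_append_le: "pair_runs a b (xs @ ys) \<le> pair_runs a b xs + pair_runs a b ys"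
  unfolding pair_runs_def filter_append by (rule runs_append_le)

lemma pair_runs_concat_le:
  "pair_runs a b (concat (map f xs)) \<le> (\<Sum>x\<leftarrow>xs. pair_runs a b (f x))"
proof (induction xs)
  case (Cons x xs)
  then show ?case using pair_runs_append_le[of a b "f x" "concat (map f xs)"] by simp
qed (simp add: pair_runs_def)

text \<open>
  This is applied with \<open>L\<close> a line that does not join \<open>a\<close> and \<open>b\<close>: however long the part of the
  sequence written with the points of \<open>L\<close> is, it only sees one of the two letters.
\<close>

lemma pair_runs_le_if_not_both:
  assumes "set xs \<subseteq> L" "\<not> (a \<in> L \<and> b \<in> L)"
  shows "pair_runs a b xs \<le> (if a \<in> L then 1 else 0) + (if b \<in> L then 1 else 0)"
proof -
  consider "a \<notin> L" "b \<notin> L" | "a \<in> L" "b \<notin> L" | "a \<notin> L" "b \<in> L"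
    using assms(2) by blast
  then show ?thesis
  proof cases
    case 1
    then have "filter (\<lambda>x. x \<in> {a, b}) xs = []"
      using assms(1) by (auto simp: filter_empty_conv)
    then show ?thesis unfolding pair_runs_def by simp
  next
    case 2
    then have "set (filter (\<lambda>x. x \<in> {a, b}) xs) \<subseteq> {a}" using assms(1) by auto
    from runs_constant[OF this] show ?thesis using 2 unfolding pair_runs_def by simp
  next
    case 3
    then have "set (filter (\<lambda>x. x \<in> {a, b}) xs) \<subseteq> {b}" using assms(1) by auto
    from runs_constant[OF this] show ?thesis using 3 unfolding pair_runs_def by simp
  qed
qed

lemma alternation_0 [simp]: "alternation 0 a b = []"
  by (simp add: alternation_def)

lemma alternation_Suc [simp]: "alternation (Suc k) a b = a # alternation k b a"
  unfolding alternation_def by (simp add: map_upt_Suc del: upt_Suc cong: if_cong)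

lemma length_alternation [simp]: "length (alternation k a b) = k"
  by (simp add: alternation_def)

lemma set_alternation: "set (alternation k a b) \<subseteq> {a, b}"
  by (auto simp: alternation_def)

lemma distinct_adj_alternation: "a \<noteq> b \<Longrightarrow> distinct_adj (alternation k a b)"
proof (induction k arbitrary: a b)
  case (Suc k)
  then show ?case by (cases k) (auto simp: distinct_adj_Cons)
qed simp

lemma take_alternation: "k \<le> m \<Longrightarrow> take k (alternation m a b) = alternation k a b"
  by (simp add: alternation_def take_map)

lemma distinct_adj_two_letters:
  assumes "distinct_adj xs" "set xs \<subseteq> {a, b}"
  shows "alternation (length xs) a b = xs \<or> alternation (length xs) b a = xs"
  using assms
proof (induction xs)
  case (Cons x xs)
  then show ?case by (cases xs) (auto simp: distinct_adj_Cons)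
qed simp

lemma alternation_subseq_imp_pair_runs:
  assumes "a \<noteq> b" "subseq (alternation k a b) xs"
  shows "k \<le> pair_runs a b xs"
proof -
  let ?P = "\<lambda>x. x \<in> {a, b}"
  have "filter ?P (alternation k a b) = alternation k a b"
    using set_alternation[of k a b] by (intro filter_True) auto
  then have "subseq (alternation k a b) (filter ?P xs)"
    using assms(2) by (metis subseq_filter)
  then have "runs (alternation k a b) \<le> pair_runs a b xs"
    unfolding pair_runs_def by (rule runs_mono)
  moreover have "remdups_adj (alternation k a b) = alternation k a b"
    using distinct_adj_alternation[OF assms(1), of k] unfolding distinct_adj_altdef .
  ultimately show ?thesis by simp
qed

lemma remdups_adj_subseq: "subseq (remdups_adj xs) xs"
proof (induction xs rule: remdups_adj.induct)
  case (3 x y xs)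
  then show ?case by (cases "x = y") (simp_all add: list_emb_Cons)
qed simp_all

lemma pair_runs_imp_alternation_subseq:
  assumes "a \<noteq> b" "k \<le> pair_runs a b xs"
  shows "subseq (alternation k a b) xs \<or> subseq (alternation k b a) xs"
proof -
  define ys where "ys = remdups_adj (filter (\<lambda>x. x \<in> {a, b}) xs)"
  have ys: "subseq ys xs"
    unfolding ys_def using remdups_adj_subseq subseq_filter_left subseq_order.trans by blast
  have "alternation (length ys) a b = ys \<or> alternation (length ys) b a = ys"
    by (rule distinct_adj_two_letters) (auto simp: ys_def)
  moreover have "k \<le> length ys"
    using assms(2) by (simp add: pair_runs_def ys_def)
  ultimately have "take k ys = alternation k a b \<or> take k ys = alternation k b a"
    using take_alternation[of k "length ys" a b] take_alternation[of k "length ys" b a] by auto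
  moreover have "subseq (take k ys) xs"
    using ys take_is_prefix prefix_imp_subseq subseq_order.trans by blast
  ultimately show ?thesis by auto
qed

lemma davenport_schinzel_iff_pair_runs:
  "davenport_schinzel s A xs \<longleftrightarrow>
     set xs \<subseteq> A \<and> distinct_adj xs \<and> (\<forall>a b. a \<noteq> b \<longrightarrow> pair_runs a b xs \<le> s + 1)"
proof -
  have "(\<forall>a b. a \<noteq> b \<longrightarrow> \<not> subseq (alternation (s + 2) a b) xs) \<longleftrightarrow>
        (\<forall>a b. a \<noteq> b \<longrightarrow> pair_runs a b xs \<le> s + 1)" (is "?L \<longleftrightarrow> ?R")
  proof
    assume L: ?L
    show ?R
    proof (intro allI impI)
      fix a b :: 'a assume "a \<noteq> b"
      then have "\<not> s + 2 \<le> pair_runs a b xs"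
        using L pair_runs_imp_alternation_subseq[of a b "s + 2" xs] by metis
      then show "pair_runs a b xs \<le> s + 1" by simp
    qed
  next
    assume R: ?R
    show ?L
    proof (intro allI impI notI)
      fix a b :: 'a assume "a \<noteq> b" "subseq (alternation (s + 2) a b) xs"
      then have "s + 2 \<le> pair_runs a b xs" by (rule alternation_subseq_imp_pair_runs)
      then show False using R \<open>a \<noteq> b\<close> by fastforce
    qed
  qed
  then show ?thesis unfolding davenport_schinzel_def by simp
qed

section \<open>The upper bound\<close>

definition pairs :: "nat \<Rightarrow> (nat \<times> nat) list" where
  "pairs n = concat (map (\<lambda>v. map (\<lambda>u. (u, v)) [0..<v]) [0..<n])"

lemma set_pairs: "set (pairs n) = {(u, v). u < v \<and> v < n}"
  by (auto simp: pairs_def)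

lemma length_pairs: "length (pairs n) = n choose 2"
proof (induction n)
  case (Suc n)
  then show ?case by (simp add: pairs_def numeral_2_eq_2)
qed (simp add: pairs_def)

lemma distinct_pairs: "distinct (pairs n)"
proof (induction n)
  case (Suc n)
  then show ?case by (auto simp: pairs_def distinct_map inj_on_def)
qed (simp add: pairs_def)

lemma finite_pairs: "finite {(u, v). u < v \<and> v < (n :: nat)}"
  using List.finite_set[of "pairs n"] unfolding set_pairs .

lemma card_pairs: "card {(u, v). u < v \<and> v < n} = n choose 2"
  by (metis distinct_card distinct_pairs length_pairs set_pairs)

fun adjacencies :: "'a \<Rightarrow> 'a \<Rightarrow> 'a list \<Rightarrow> nat" where
  "adjacencies a b (x # y # xs) = (if {x, y} = {a, b} then 1 else 0) + adjacencies a b (y # xs)"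
| "adjacencies a b xs = 0"

text \<open>
  The second letter of each adjacency of \<open>a\<close> and \<open>b\<close> starts a new run of the list restricted to
  these two letters, and the very first run is started by none of them.
\<close>

lemma adjacencies_le_pair_runs: "a \<noteq> b \<Longrightarrow> adjacencies a b xs \<le> pair_runs a b xs - 1"
proof (induction a b xs rule: adjacencies.induct)
  case (1 a b x y xs)
  show ?case
  proof (cases "{x, y} = {a, b}")
    case True
    then have "pair_runs a b (x # y # xs) = Suc (pair_runs a b (y # xs))"
      using 1(2) by (auto simp: pair_runs_def doubleton_eq_iff)
    moreover have "pair_runs a b (y # xs) \<ge> 1"
      using True by (auto simp: pair_runs_def doubleton_eq_iff Suc_le_eq)
    ultimately show ?thesis using True 1 by auto
  next
    case False
    have "pair_runs a b (y # xs) \<le> pair_runs a b (x # y # xs)"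
      unfolding pair_runs_def by (rule runs_mono) auto
    then show ?thesis using False 1 by auto
  qed
qed auto

lemma length_le_sum_adjacencies:
  fixes xs :: "nat list"
  assumes "distinct_adj xs" "set xs \<subseteq> {..<n}"
  shows "length xs \<le> Suc (\<Sum>(u, v)\<in>{(u, v). u < v \<and> v < n}. adjacencies u v xs)"
  using assms
proof (induction xs rule: induct_list012)
  case (3 x y xs)
  let ?D = "{(u, v). u < v \<and> v < n}"

  \<comment> \<open>The first adjacency is counted for exactly one pair \<open>u < v\<close>, namely for \<open>p\<close>.\<close>
  define p where "p = (min x y, max x y)"
  have p: "p \<in> ?D" using 3(3,4) by (auto simp: p_def min_def max_def)
  have "(\<Sum>(u, v)\<in>?D. adjacencies u v (x # y # xs)) =
        (\<Sum>e\<in>?D. (if e = p then 1 else 0) + (case e of (u, v) \<Rightarrow> adjacencies u v (y # xs)))"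
  proof (rule sum.cong[OF refl])
    fix e assume "e \<in> ?D"
    then obtain u v where e: "e = (u, v)" "u < v" by blast
    then have "{x, y} = {u, v} \<longleftrightarrow> e = p"
      by (cases "x \<le> y") (auto simp: p_def doubleton_eq_iff)
    then show "(case e of (u, v) \<Rightarrow> adjacencies u v (x # y # xs)) =
        (if e = p then 1 else 0) + (case e of (u, v) \<Rightarrow> adjacencies u v (y # xs))"
      by (simp add: e(1))
  qed
  also have "\<dots> = Suc (\<Sum>(u, v)\<in>?D. adjacencies u v (y # xs))"
    using finite_pairs[of n] p by (simp add: sum.distrib)
  finally have "(\<Sum>(u, v)\<in>?D. adjacencies u v (x # y # xs)) =
      Suc (\<Sum>(u, v)\<in>?D. adjacencies u v (y # xs))" .
  moreover have "length (y # xs) \<le> Suc (\<Sum>(u, v)\<in>?D. adjacencies u v (y # xs))"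
    by (rule 3(2)) (use 3(3,4) in auto)
  ultimately show ?case by simp
qed auto

lemma davenport_schinzel_length_le:
  assumes "davenport_schinzel s {..<m} xs"
  shows "length xs \<le> (m choose 2) * s + 1"
proof -
  have *: "set xs \<subseteq> {..<m}" "distinct_adj xs" "\<And>a b. a \<noteq> b \<Longrightarrow> pair_runs a b xs \<le> s + 1"
    using assms unfolding davenport_schinzel_iff_pair_runs by auto
  have "length xs \<le> Suc (\<Sum>(u, v)\<in>{(u, v). u < v \<and> v < m}. adjacencies u v xs)"
    using length_le_sum_adjacencies * by blast
  also have "(\<Sum>(u, v)\<in>{(u, v). u < v \<and> v < m}. adjacencies u v xs)
             \<le> (\<Sum>(u, v)\<in>{(u, v). u < v \<and> v < m}. s)"
  proof (rule sum_mono)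
    fix e assume "e \<in> {(u, v). u < v \<and> v < m}"
    then show "(case e of (u, v) \<Rightarrow> adjacencies u v xs) \<le> (case e of (u, v) \<Rightarrow> s)"
      using adjacencies_le_pair_runs[of "fst e" "snd e" xs] *(3)[of "fst e" "snd e"] by auto
  qed
  also have "\<dots> = (m choose 2) * s"
    using card_pairs[of m] by (simp add: case_prod_unfold)
  finally show ?thesis by simp
qed

lemma finite_ds_lengths: "finite {length xs | xs :: nat list. davenport_schinzel s {..<m} xs}"
  by (rule finite_subset[of _ "{..(m choose 2) * s + 1}"]) (auto dest: davenport_schinzel_length_le)

lemma ds_max_length_ge: "davenport_schinzel s {..<m} xs \<Longrightarrow> length xs \<le> ds_max_length s m"
  unfolding ds_max_length_def by (rule Max_ge[OF finite_ds_lengths]) auto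

lemma ds_max_length_le: "ds_max_length s m \<le> (m choose 2) * s + 1"
proof -
  have "davenport_schinzel s {..<m} []"
    by (simp add: davenport_schinzel_def)
  then have "{length xs | xs :: nat list. davenport_schinzel s {..<m} xs} \<noteq> {}"
    by blast
  then show ?thesis
    unfolding ds_max_length_def
    by (subst Max_le_iff[OF finite_ds_lengths]) (auto dest: davenport_schinzel_length_le)
qed

section \<open>Long sequences from linear spaces\<close>

definition zigzag :: "nat \<Rightarrow> nat \<times> nat \<Rightarrow> nat list" where
  "zigzag k e = alternation (2 * k) (fst e) (snd e)"

lemma set_zigzag: "set (zigzag k e) \<subseteq> {fst e, snd e}"
  unfolding zigzag_def by (rule set_alternation)

text \<open>
  Consecutive blocks may meet in equal letters. Removing these repetitions costs at most one letter
  per block, which is negligible against the block length \<open>2 k\<close>.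
\<close>

lemma runs_concat_zigzag_ge:
  assumes "\<forall>e\<in>set es. fst e \<noteq> snd e"
  shows "length es * (2 * k - 1) \<le> runs (concat (map (zigzag k) es))"
  using assms
proof (induction es)
  case (Cons e es)
  have "remdups_adj (zigzag k e) = zigzag k e"
    using Cons.prems unfolding zigzag_def
    by (intro distinct_adj_altdef[THEN iffD1] distinct_adj_alternation) auto
  then have "runs (zigzag k e) = 2 * k" by (simp add: zigzag_def)
  then show ?case
    using runs_append_ge[of "zigzag k e" "concat (map (zigzag k) es)"] Cons by auto
qed simp

text \<open>
  The three summands are kept separate so that they can be summed over all pairs within a line: the
  first contributes once, the others once per pair incident with \<open>a\<close> or \<open>b\<close>.
\<close>

lemma pair_runs_zigzag_le:
  assumes "a \<noteq> b" "u < v"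
  shows "pair_runs a b (zigzag k (u, v)) \<le>
     (if (u, v) = (min a b, max a b) then 2 * k else 0)
       + (if a \<in> {u, v} then 1 else 0) + (if b \<in> {u, v} then 1 else 0)"
proof (cases "(u, v) = (min a b, max a b)")
  case True
  have "pair_runs a b (zigzag k (u, v)) \<le> length (zigzag k (u, v))"
    unfolding pair_runs_def by (meson length_filter_le order_trans remdups_adj_length)
  then show ?thesis using True by (simp add: zigzag_def)
next
  case False
  then have "\<not> (a \<in> {u, v} \<and> b \<in> {u, v})"
    using assms by (auto simp: min_def max_def)
  then have "pair_runs a b (zigzag k (u, v))
      \<le> (if a \<in> {u, v} then 1 else 0) + (if b \<in> {u, v} then 1 else 0)"
    using set_zigzag[of k "(u, v)"] by (intro pair_runs_le_if_not_both) simp_all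
  then show ?thesis by linarith
qed

lemma sum_if_eq_card:
  "finite A \<Longrightarrow> (\<Sum>x\<in>A. if P x then 1 else 0) = card {x \<in> A. P x}"
  by (simp flip: sum.inter_filter)

text \<open>
  The pairs are listed line by line. The alternations of \<open>a\<close> and \<open>b\<close> then split into three kinds:
  \<open>2 k\<close> in their own block, at most \<open>2 g\<close> from the other blocks of the line \<open>ab\<close>, and one for each
  of the at most \<open>2 f\<close> further lines through \<open>a\<close> or \<open>b\<close>.
\<close>

lemma ds_max_length_ge_linear_space:
  fixes \<L> :: "nat set set"
  assumes fin: "finite \<L>"
    and join: "\<And>a b. a < n \<Longrightarrow> b < n \<Longrightarrow> a \<noteq> b \<Longrightarrow> \<exists>!L. L \<in> \<L> \<and> a \<in> L \<and> b \<in> L"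
    and degree: "\<And>a. a < n \<Longrightarrow> card {L \<in> \<L>. a \<in> L} \<le> f"
    and size: "\<And>L. L \<in> \<L> \<Longrightarrow> finite L \<and> card L \<le> g"
    and order: "2 * k + 2 * f + 2 * g \<le> s + 1"
  shows "(n choose 2) * (2 * k - 1) \<le> ds_max_length s n"
proof -
  obtain Ls where Ls: "set Ls = \<L>" "distinct Ls"
    using finite_distinct_list[OF fin] by blast
  define part where "part L = filter (\<lambda>(u, v). u \<in> L \<and> v \<in> L) (pairs n)" for L
  define es where "es = concat (map part Ls)"
  define xs where "xs = remdups_adj (concat (map (zigzag k) es))"
  have set_part: "set (part L) = {(u, v). u < v \<and> v < n \<and> u \<in> L \<and> v \<in> L}" for L
    by (auto simp: part_def set_pairs)
  have set_es: "set es = {(u, v). u < v \<and> v < n}"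
  proof (intro equalityI subsetI)
    fix e assume "e \<in> {(u, v). u < v \<and> v < n}"
    then obtain u v where e: "e = (u, v)" "u < v" "v < n" by blast
    then obtain L where "L \<in> \<L>" "u \<in> L" "v \<in> L"
      using join[of u v] by auto
    then show "e \<in> set es"
      using e Ls(1) by (auto simp: es_def set_part)
  qed (auto simp: es_def set_part)
  \<comment> \<open>Each pair is listed at least once since it has a joining line, and at most once since the
    line is unique.\<close>
  have "length es = n choose 2"
  proof -
    have "card (set es) \<le> length es" by (rule card_length)
    then have "n choose 2 \<le> length es" by (simp add: set_es card_pairs)
    moreover have "length es \<le> n choose 2"
    proof -
      have "length (part L) = card (set (part L))" for L
        by (intro distinct_card[symmetric]) (simp add: part_def distinct_pairs)
      then have "length es = (\<Sum>L\<in>\<L>. card (set (part L)))"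
        using Ls by (simp add: es_def length_concat sum_list_distinct_conv_sum_set comp_def)
      also have "\<dots> = card (\<Union>L\<in>\<L>. set (part L))"
      proof (rule card_UN_disjoint[symmetric, OF fin])
        show "\<forall>L\<in>\<L>. finite (set (part L))" by simp
        have "L = L'" if L: "L \<in> \<L>" "L' \<in> \<L>" "e \<in> set (part L)" "e \<in> set (part L')" for L L' e
        proof -
          obtain u v where "u < v" "v < n" "u \<in> L" "v \<in> L" "u \<in> L'" "v \<in> L'"
            using L(3,4) by (auto simp: set_part)
          then show ?thesis using join[of u v] L(1,2) by auto
        qed
        then show "\<forall>L\<in>\<L>. \<forall>L'\<in>\<L>. L \<noteq> L' \<longrightarrow> set (part L) \<inter> set (part L') = {}"
          by blast
      qed
      also have "\<dots> \<le> card {(u, v). u < v \<and> v < n}"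
        by (intro card_mono finite_pairs) (auto simp: set_part)
      finally show ?thesis by (simp add: card_pairs)
    qed
    ultimately show ?thesis by simp
  qed
  then have length_xs: "(n choose 2) * (2 * k - 1) \<le> length xs"
    using runs_concat_zigzag_ge[of es k] set_es unfolding xs_def by auto
  have set_xs: "set xs \<subseteq> {..<n}"
    using set_zigzag[of k] set_es unfolding xs_def by fastforce
  have "pair_runs a b xs \<le> s + 1" if ab: "a \<noteq> b" for a b
  proof (cases "a < n \<and> b < n")
    case False
    then have "\<not> (a \<in> set xs \<and> b \<in> set xs)" using set_xs by auto
    then show ?thesis
      using pair_runs_le_if_not_both[OF order_refl, of a xs b] by (auto split: if_splits)
  next
    case True
    obtain M where M: "M \<in> \<L>" "a \<in> M" "b \<in> M"
      and uniq: "\<And>L. L \<in> \<L> \<Longrightarrow> a \<in> L \<Longrightarrow> b \<in> L \<Longrightarrow> L = M"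
      using join[of a b] True ab by blast
    define w where "w L = concat (map (zigzag k) (part L))" for L
    have set_w: "set (w L) \<subseteq> L" for L
      using set_zigzag[of k] unfolding w_def by (fastforce simp: set_part)
    have own: "pair_runs a b (w M) \<le> 2 * k + 2 * g"
    proof -
      have star: "card {e \<in> set (part M). c \<in> {fst e, snd e}} \<le> g" for c
      proof -
        have fin_M: "finite M" "card M \<le> g" using size[OF M(1)] by auto
        have "{e \<in> set (part M). c \<in> {fst e, snd e}} \<subseteq> (\<lambda>d. (min c d, max c d)) ` M"
        proof
          fix e assume "e \<in> {e \<in> set (part M). c \<in> {fst e, snd e}}"
          then obtain u v where e: "e = (u, v)" "u < v" "u \<in> M" "v \<in> M" "c = u \<or> c = v"
            by (auto simp: set_part)
          then have "e = (min c v, max c v) \<or> e = (min c u, max c u)" by auto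
          then show "e \<in> (\<lambda>d. (min c d, max c d)) ` M" using e(3,4) by blast
        qed
        then have "card {e \<in> set (part M). c \<in> {fst e, snd e}}
            \<le> card ((\<lambda>d. (min c d, max c d)) ` M)"
          using fin_M(1) by (intro card_mono) auto
        also have "\<dots> \<le> card M" using fin_M(1) by (rule card_image_le)
        finally show ?thesis using fin_M(2) by linarith
      qed
      have "pair_runs a b (w M) \<le> (\<Sum>e\<leftarrow>part M. pair_runs a b (zigzag k e))"
        unfolding w_def by (rule pair_runs_concat_le)
      also have "\<dots> = (\<Sum>e\<in>set (part M). pair_runs a b (zigzag k e))"
        by (intro sum_list_distinct_conv_sum_set) (simp add: part_def distinct_pairs)
      also have "\<dots> \<le> (\<Sum>e\<in>set (part M). (if e = (min a b, max a b) then 2 * k else 0)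
          + (if a \<in> {fst e, snd e} then 1 else 0) + (if b \<in> {fst e, snd e} then 1 else 0))"
      proof (rule sum_mono)
        fix e assume "e \<in> set (part M)"
        then obtain u v where e: "e = (u, v)" "u < v" by (auto simp: set_part)
        show "pair_runs a b (zigzag k e) \<le> (if e = (min a b, max a b) then 2 * k else 0)
          + (if a \<in> {fst e, snd e} then 1 else 0) + (if b \<in> {fst e, snd e} then 1 else 0)"
          unfolding e(1) fst_conv snd_conv using ab e(2) by (rule pair_runs_zigzag_le)
      qed
      also have "\<dots> \<le> 2 * k + card {e \<in> set (part M). a \<in> {fst e, snd e}}
          + card {e \<in> set (part M). b \<in> {fst e, snd e}}"
        unfolding sum.distrib sum_if_eq_card[OF List.finite_set]
        by (intro add_mono order_refl) (simp add: sum.delta)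
      finally show ?thesis using star[of a] star[of b] by linarith
    qed
    have other: "pair_runs a b (w L) \<le> (if a \<in> L then 1 else 0) + (if b \<in> L then 1 else 0)"
      if "L \<in> \<L>" "L \<noteq> M" for L
    proof -
      have "\<not> (a \<in> L \<and> b \<in> L)" using that uniq by blast
      with set_w show ?thesis by (rule pair_runs_le_if_not_both)
    qed
    have "concat (map (zigzag k) es) = concat (map w Ls)"
      unfolding es_def w_def by (induction Ls) auto
    then have "subseq xs (concat (map w Ls))"
      unfolding xs_def using remdups_adj_subseq by metis
    then have "pair_runs a b xs \<le> pair_runs a b (concat (map w Ls))"
      unfolding pair_runs_def by (intro runs_mono subseq_filter)
    also have "\<dots> \<le> (\<Sum>L\<in>\<L>. pair_runs a b (w L))"
      using pair_runs_concat_le[of a b w Ls]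
      unfolding sum_list_distinct_conv_sum_set[OF Ls(2)] Ls(1) .
    also have "\<dots> \<le> (\<Sum>L\<in>\<L>. (if L = M then 2 * k + 2 * g else 0)
        + (if a \<in> L then 1 else 0) + (if b \<in> L then 1 else 0))"
    proof (rule sum_mono)
      fix L assume "L \<in> \<L>"
      then show "pair_runs a b (w L) \<le> (if L = M then 2 * k + 2 * g else 0)
          + (if a \<in> L then 1 else 0) + (if b \<in> L then 1 else 0)"
        using own other[of L] by (cases "L = M") auto
    qed
    also have "\<dots> = 2 * k + 2 * g + card {L \<in> \<L>. a \<in> L} + card {L \<in> \<L>. b \<in> L}"
      unfolding sum.distrib sum_if_eq_card[OF fin] using fin M(1) by (simp add: sum.delta)
    also have "\<dots> \<le> s + 1"
      using degree[of a] degree[of b] True order by linarith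
    finally show ?thesis .
  qed
  then have "davenport_schinzel s {..<n} xs"
    using set_xs unfolding davenport_schinzel_iff_pair_runs xs_def by simp
  then show ?thesis using ds_max_length_ge length_xs order_trans by blast
qed

section \<open>Lines of slope modulo q in a narrow strip\<close>

text \<open>
  Two points in different columns determine the slope of their line as a quotient modulo \<open>q\<close>; the
  divisor is a nonzero difference of column numbers, so it divides \<open>r!\<close> and is coprime to \<open>q\<close>.
  Two points of one column lie on no such line, because they have different heights modulo \<open>q\<close>; the column itself joins them.
\<close>

lemma strip_linear_space:
  fixes n r q :: nat
  assumes q: "[q = 1] (mod fact r)" and "r \<le> q" "n \<le> r * q" "0 < q"
  obtains \<L> :: "nat set set" where "finite \<L>"
    and "\<And>a b. a < n \<Longrightarrow> b < n \<Longrightarrow> a \<noteq> b \<Longrightarrow> \<exists>!L. L \<in> \<L> \<and> a \<in> L \<and> b \<in> L"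
    and "\<And>a. a < n \<Longrightarrow> card {L \<in> \<L>. a \<in> L} \<le> q + 1"
    and "\<And>L. L \<in> \<L> \<Longrightarrow> finite L \<and> card L \<le> q"
proof -
  define x y :: "nat \<Rightarrow> int" where "x a = int (a div q)" and "y a = int (a mod q)" for a
  have x: "0 \<le> x a" "x a < int r" if "a < n" for a
    using that assms(3,4) by (auto simp: x_def less_mult_imp_div_less)
  have y: "0 \<le> y a" "y a < int q" for a
    using assms(4) by (auto simp: y_def)
  have xy: "a = b" if "x a = x b" "y a = y b" for a b
    using that by (simp add: x_def y_def) (metis div_mult_mod_eq)
  have inverse: "\<exists>u. [(x b - x a) * u = 1] (mod int q)" if "a < n" "b < n" "x a \<noteq> x b" for a b
  proof (rule cong_solve_coprime_int)
    define d where "d = nat \<bar>x b - x a\<bar>"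
    have "0 < d" "d \<le> r" using x[of a] x[of b] that by (auto simp: d_def)
    then have "d dvd fact r" by (intro dvd_fact) auto
    then have "[q = 1] (mod d)" using q cong_dvd_modulus_nat by blast
    then have "coprime q d" by (metis cong_imp_coprime cong_sym coprime_1_left)
    then have "coprime (int d) (int q)" by (simp add: coprime_commute)
    then show "coprime (x b - x a) (int q)" by (simp add: d_def)
  qed
  \<comment> \<open>Describing a line by one of its points and its slope, rather than by slope and intercept,
    lets every line through \<open>a\<close> be written with base point \<open>a\<close>.\<close>
  define line where
    "line a k = {b. b < n \<and> [y b - y a = k * (x b - x a)] (mod int q)}" for a k
  define column where "column i = {b. b < n \<and> x b = i}" for i
  define \<L> where "\<L> = range column \<union> (\<Union>a. line a ` {0..<int q})"
  have line_base: "line a k = line p k" if "p \<in> line a k" for a k p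
  proof -
    have p: "[y p - y a = k * (x p - x a)] (mod int q)" using that by (simp add: line_def)
    have "[y b - y a = k * (x b - x a)] (mod int q) \<longleftrightarrow> [y b - y p = k * (x b - x p)] (mod int q)" for b
      using cong_diff[OF _ p, of "y b - y a" "k * (x b - x a)"]
        cong_add[OF _ p, of "y b - y p" "k * (x b - x p)"]
      by (auto simp: algebra_simps)
    then show ?thesis by (auto simp: line_def)
  qed
  have slope_unique: "k = l"
    if on: "b \<in> line a k" "b \<in> line a l" and "a < n" "x a \<noteq> x b"
      and slopes: "k \<in> {0..<int q}" "l \<in> {0..<int q}" for a b k l
  proof -
    obtain u where u: "[(x b - x a) * u = 1] (mod int q)"
      using inverse[of a b] on(1) \<open>a < n\<close> \<open>x a \<noteq> x b\<close> unfolding line_def by blast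
    have "[k * (x b - x a) = l * (x b - x a)] (mod int q)"
      using on unfolding line_def by (blast intro: cong_trans cong_sym)
    then have "[k * (x b - x a) * u = l * (x b - x a) * u] (mod int q)"
      by (rule cong_scalar_right)
    moreover have "[m * (x b - x a) * u = m] (mod int q)" for m
      using cong_scalar_left[OF u, of m] by (simp add: mult.assoc)
    ultimately have "[k = l] (mod int q)" by (meson cong_sym cong_trans)
    then show ?thesis using slopes by (simp add: unique_euclidean_semiring_class.cong_def)
  qed
  have same_column: "a = b" if "b \<in> line a k" "x a = x b" for a b k
  proof -
    have "[y b - y a = 0] (mod int q)" using that by (simp add: line_def)
    then have "[y b = y a] (mod int q)" by (simp add: cong_diff_iff_cong_0)
    then have "y b = y a" using y by (simp add: unique_euclidean_semiring_class.cong_def)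
    then show ?thesis using that xy by simp
  qed
  show thesis
  proof
    show "finite \<L>"
      by (rule finite_subset[of _ "Pow {..<n}"]) (auto simp: \<L>_def line_def column_def)
  next
    fix a b assume ab: "a < n" "b < n" "a \<noteq> b"
    show "\<exists>!L. L \<in> \<L> \<and> a \<in> L \<and> b \<in> L"
    proof (cases "x a = x b")
      case True
      show ?thesis
      proof (rule ex1I[of _ "column (x a)"])
        show "column (x a) \<in> \<L> \<and> a \<in> column (x a) \<and> b \<in> column (x a)"
          using ab True by (auto simp: \<L>_def column_def)
      next
        fix L assume L: "L \<in> \<L> \<and> a \<in> L \<and> b \<in> L"
        have "L \<noteq> line c k" for c k
          using L line_base[of a c k] same_column[of b a k] True ab by blast
        then show "L = column (x a)" using L by (auto simp: \<L>_def column_def)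
      qed
    next
      case False
      obtain u where u: "[(x b - x a) * u = 1] (mod int q)"
        using inverse[of a b] ab False by blast
      define k where "k = ((y b - y a) * u) mod int q"
      have k: "k \<in> {0..<int q}" using assms(4) by (simp add: k_def)
      have "[k * (x b - x a) = (y b - y a) * u * (x b - x a)] (mod int q)"
        by (rule cong_scalar_right) (simp add: k_def unique_euclidean_semiring_class.cong_def)
      moreover have "[(y b - y a) * u * (x b - x a) = y b - y a] (mod int q)"
        using cong_scalar_left[OF u, of "y b - y a"] by (simp add: ac_simps)
      ultimately have "[y b - y a = k * (x b - x a)] (mod int q)"
        by (meson cong_sym cong_trans)
      then have bk: "b \<in> line a k" using ab by (simp add: line_def)
      show ?thesis
      proof (rule ex1I[of _ "line a k"])
        show "line a k \<in> \<L> \<and> a \<in> line a k \<and> b \<in> line a k"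
        proof (intro conjI)
          show "line a k \<in> \<L>" using k unfolding \<L>_def by blast
          show "a \<in> line a k" using ab by (simp add: line_def)
          show "b \<in> line a k" by (fact bk)
        qed
      next
        fix L assume L: "L \<in> \<L> \<and> a \<in> L \<and> b \<in> L"
        then obtain c l where l: "L = line c l" "l \<in> {0..<int q}"
          using False by (auto simp: \<L>_def column_def)
        then have "L = line a l" using L line_base by blast
        then show "L = line a k"
          using slope_unique[of b a l k] L l bk k ab False by blast
      qed
    qed
  next
    fix a assume "a < n"
    have "{L \<in> \<L>. a \<in> L} \<subseteq> insert (column (x a)) (line a ` {0..<int q})"
    proof
      fix L assume "L \<in> {L \<in> \<L>. a \<in> L}"
      then have L: "L \<in> \<L>" "a \<in> L" by auto
      then consider i where "L = column i" | c k where "L = line c k" "k \<in> {0..<int q}"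
        unfolding \<L>_def by blast
      then show "L \<in> insert (column (x a)) (line a ` {0..<int q})"
      proof cases
        case 1
        then show ?thesis using L(2) by (simp add: column_def)
      next
        case 2
        then show ?thesis using line_base[of a c k] L(2) by blast
      qed
    qed
    then have "card {L \<in> \<L>. a \<in> L} \<le> card (insert (column (x a)) (line a ` {0..<int q}))"
      by (intro card_mono) auto
    also have "\<dots> \<le> Suc (card (line a ` {0..<int q}))"
      by (rule card_insert_le_m1) auto
    also have "\<dots> \<le> q + 1"
      using card_image_le[of "{0..<int q}" "line a"] by simp
    finally show "card {L \<in> \<L>. a \<in> L} \<le> q + 1" .
  next
    fix L assume "L \<in> \<L>"
    then have sub: "L \<subseteq> {..<n}" by (auto simp: \<L>_def line_def column_def)
    consider i where "L = column i" | c k where "L = line c k"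
      using \<open>L \<in> \<L>\<close> by (auto simp: \<L>_def)
    then have "card L \<le> q"
    proof cases
      case 1
      have "inj_on y L" "y ` L \<subseteq> {0..<int q}"
        using xy y 1 by (auto simp: inj_on_def column_def)
      then show ?thesis using card_inj_on_le[of y L "{0..<int q}"] by simp
    next
      case 2
      have "inj_on x L"
        using 2 line_base same_column by (metis inj_onI)
      moreover have "x ` L \<subseteq> {0..<int r}"
        using x sub by force
      ultimately have "card L \<le> r" using card_inj_on_le[of x L "{0..<int r}"] by simp
      then show ?thesis using assms(2) by simp
    qed
    then show "finite L \<and> card L \<le> q" using sub finite_subset by blast
  qed
qed

text \<open>
  The strip has height \<open>q = n / r + O(1)\<close>, and the order \<open>n\<close> leaves room for blocks of
  length \<open>2 k = n - 4 q - O(1)\<close>.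
\<close>

lemma ds_max_length_diagonal_ge:
  fixes n r :: nat
  assumes "0 < r"
  shows "real (n choose 2) * (real n - 4 * real n / real r - (4 * fact r + 7))
           \<le> real (ds_max_length n n)"
proof -
  define j where "j = n div (r * fact r) + 1"
  define q where "q = 1 + fact r * j"
  define k where "k = (n - (4 * q + 1)) div 2"
  have "n < r * fact r * j"
    unfolding j_def using assms dividend_less_times_div[of "r * fact r" n] by simp
  then have nq: "n \<le> r * q" by (simp add: q_def algebra_simps)
  have "r \<le> fact r * j"
    using fact_ge_self[of r] by (simp add: j_def algebra_simps)
  then have rq: "r \<le> q" by (simp add: q_def)
  have "[q = 1] (mod fact r)" unfolding q_def unique_euclidean_semiring_class.cong_def by (rule mod_mult_self2)
  then obtain \<L> where \<L>: "finite \<L>"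
    "\<And>a b. a < n \<Longrightarrow> b < n \<Longrightarrow> a \<noteq> b \<Longrightarrow> \<exists>!L. L \<in> \<L> \<and> a \<in> L \<and> b \<in> L"
    "\<And>a. a < n \<Longrightarrow> card {L \<in> \<L>. a \<in> L} \<le> q + 1"
    "\<And>L. L \<in> \<L> \<Longrightarrow> finite L \<and> card L \<le> q"
    using strip_linear_space[of q r n] rq nq by (auto simp: q_def)
  have "real (n div (r * fact r)) \<le> real n / real (r * fact r)"
    by (rule of_nat_div_le_of_nat)
  then have "real (fact r * (n div (r * fact r))) \<le> real n / real r"
    using assms by (simp add: field_simps)
  then have "real q \<le> 1 + fact r + real n / real r"
    by (simp add: q_def j_def algebra_simps)
  then have bound: "real n - 4 * real n / real r - (4 * fact r + 7) \<le> real n - 4 * real q - 3"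
    by simp
  \<comment> \<open>If \<open>n \<le> 4 q\<close>, the alternations between the blocks may exceed the order even for empty blocks,
    but then the left-hand side is not positive.\<close>
  have "real (n choose 2) * (real n - 4 * real q - 3) \<le> real (ds_max_length n n)"
  proof (cases "4 * q + 1 \<le> n")
    case True
    have "(n choose 2) * (2 * k - 1) \<le> ds_max_length n n"
      by (rule ds_max_length_ge_linear_space[OF \<L>]) (use True in \<open>auto simp: k_def\<close>)
    then have "real (n choose 2) * real (2 * k - 1) \<le> real (ds_max_length n n)"
      by (metis of_nat_le_iff of_nat_mult)
    moreover have "n \<le> (2 * k - 1) + 4 * q + 3" unfolding k_def by linarith
    then have "real n - 4 * real q - 3 \<le> real (2 * k - 1)" by linarith
    ultimately show ?thesis
      by (meson mult_left_mono of_nat_0_le_iff order_trans)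
  next
    case False
    then have "real n - 4 * real q - 3 \<le> 0" by linarith
    then have "real (n choose 2) * (real n - 4 * real q - 3) \<le> 0"
      by (intro mult_nonneg_nonpos) auto
    then show ?thesis using of_nat_0_le_iff order_trans by blast
  qed
  then show ?thesis using bound by (meson mult_left_mono of_nat_0_le_iff order_trans)
qed

lemma real_choose_two: "real (n choose 2) = real n * (real n - 1) / 2"
proof -
  have "even (n * (n - 1))" by (cases n) auto
  then have "2 * (n choose 2) = n * (n - 1)" unfolding choose_two by (rule dvd_mult_div_cancel)
  then have "2 * real (n choose 2) = real n * real (n - 1)"
    by (metis of_nat_mult of_nat_numeral)
  then show ?thesis by (cases n) auto
qed

theorem corollary5:
  shows "(\<lambda>n::nat. real (ds_max_length n n) / real n ^ 3) \<longlonglongrightarrow> 1 / 2"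
proof (rule order_tendstoI)
  fix c :: real assume "1 / 2 < c"
  have "(\<lambda>n::nat. (real n * (real n - 1) / 2 * real n + 1) / real n ^ 3) \<longlonglongrightarrow> 1 / 2"
    by real_asymp
  then have "eventually (\<lambda>n::nat. (real n * (real n - 1) / 2 * real n + 1) / real n ^ 3 < c) sequentially"
    using \<open>1 / 2 < c\<close> by (rule order_tendstoD)
  then show "eventually (\<lambda>n::nat. real (ds_max_length n n) / real n ^ 3 < c) sequentially"
  proof eventually_elim
    case (elim n)
    have "real (ds_max_length n n) \<le> real ((n choose 2) * n + 1)"
      using ds_max_length_le of_nat_le_iff by blast
    then have "real (ds_max_length n n) \<le> real n * (real n - 1) / 2 * real n + 1"
      by (simp add: real_choose_two)
    then show ?case using elim
      by (meson divide_right_mono le_less_trans of_nat_0_le_iff zero_le_power)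
  qed
next
  fix c :: real assume c: "c < 1 / 2"
  obtain r :: nat where r: "2 / (1 / 2 - c) < real r"
    using reals_Archimedean2 by blast
  then have "0 < real r"
    using c by (meson diff_gt_0_iff_gt divide_pos_pos less_trans zero_less_numeral)
  then have r0: "0 < r" and cr: "c < 1 / 2 - 2 / real r"
    using r c by (auto simp: field_simps)
  define t D :: real where "t = 4 / real r" and "D = 4 * fact r + 7"
  have "(\<lambda>n::nat. real n * (real n - 1) / 2 * (real n - t * real n - D) / real n ^ 3)
          \<longlonglongrightarrow> (1 - t) / 2"
    by real_asymp
  moreover have "c < (1 - t) / 2" using cr by (simp add: t_def field_simps)
  ultimately have "eventually (\<lambda>n::nat.
      c < real n * (real n - 1) / 2 * (real n - t * real n - D) / real n ^ 3) sequentially"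
    by (rule order_tendstoD)
  then show "eventually (\<lambda>n::nat. c < real (ds_max_length n n) / real n ^ 3) sequentially"
  proof eventually_elim
    case (elim n)
    have "real n * (real n - 1) / 2 * (real n - t * real n - D) \<le> real (ds_max_length n n)"
      using ds_max_length_diagonal_ge[OF r0, of n] by (simp add: real_choose_two t_def D_def)
    then show ?case using elim
      by (meson divide_right_mono less_le_trans of_nat_0_le_iff zero_le_power)
  qed
qed

end
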